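(* Let $q$ be odd and let $(V,E)$ be a $q$-manifold. Let $(\Omega,\mathcal{A},\mathrm{P})$ be a probability space of locally injective functions $g:V\to\mathbb{R}$ such that $g\mapsto -g$ is an automorphism of the probability space. Then the index expectation curvature $K(v)=\mathrm{E}[i_g(v)]$ is zero for every $v\in V$ (odd-dimensional manifolds are flat).
   Context: All graphs are finite simple graphs; $S(v)$ is the subgraph induced by the neighbors of $v$, $G\setminus v$ is the graph with $v$ removed. Contractible graphs: $K_1$ is contractible, and $G$ is contractible if there is a vertex $v$ such that $S(v)$ and $G\setminus v$ are both contractible; the empty graph is not contractible. The empty graph is the $(-1)$-sphere; for $q\ge0$ a $q$-manifold is a graph all of whose unit spheres $S(v)$ are $(q-1)$-spheres, and a $q$-sphere is a $q$-manifold for which there is a vertex $v$ with $G\setminus v$ contractible. The Euler characteristic $\chi$ of a graph is $\sum_x(-1)^{\dim(x)}$ over its non-empty cliques $x$, where $\dim(x)=|x|-1$. A function $g$ is locally injective if $g(v)\ne g(w)$ for $(v,w)\in E$. The index is $i_g(v)=1-\chi(S_g^-(v))$, where $S_g^-(v)$ is the subgraph induced by the neighbors $w$ of $v$ with $g(w)<g(v)$; it is a random variable on $\Omega$. $\mathrm{E}$ is expectation with respect to $\mathrm{P}$. *)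

theory Defs
  imports "HOL-Probability.Probability"
begin

definition simple_graph :: "'a set \<Rightarrow> 'a set set \<Rightarrow> bool" where
  "simple_graph V E \<longleftrightarrow>
     finite V \<and> (\<forall>e\<in>E. \<exists>u\<in>V. \<exists>v\<in>V. u \<noteq> v \<and> e = {u, v})"

definition nbrs :: "'a set set \<Rightarrow> 'a \<Rightarrow> 'a set" where
  "nbrs E v = {w. {v, w} \<in> E}"

definition induced_edges :: "'a set set \<Rightarrow> 'a set \<Rightarrow> 'a set set" where
  "induced_edges E W = {e \<in> E. e \<subseteq> W}"

inductive contractible_graph :: "'a set \<Rightarrow> 'a set set \<Rightarrow> bool" where
  K1: "contractible_graph {v} {}"
| extend: "v \<in> V
    \<Longrightarrow> contractible_graph (nbrs E v) (induced_edges E (nbrs E v))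
    \<Longrightarrow> contractible_graph (V - {v}) (induced_edges E (V - {v}))
    \<Longrightarrow> contractible_graph V E"

text \<open>The dimension is an integer because the recursion starts at dimension \<open>-1\<close>.\<close>

inductive graph_sphere :: "int \<Rightarrow> 'a set \<Rightarrow> 'a set set \<Rightarrow> bool"
  and graph_manifold :: "int \<Rightarrow> 'a set \<Rightarrow> 'a set set \<Rightarrow> bool" where
  empty_sphere: "graph_sphere (- 1) {} {}"
| manifold: "q \<ge> 0
    \<Longrightarrow> (\<forall>v\<in>V. graph_sphere (q - 1) (nbrs E v) (induced_edges E (nbrs E v)))
    \<Longrightarrow> graph_manifold q V E"
| sphere: "graph_manifold q V E \<Longrightarrow> v \<in> V
    \<Longrightarrow> contractible_graph (V - {v}) (induced_edges E (V - {v}))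
    \<Longrightarrow> graph_sphere q V E"

definition cliques :: "'a set \<Rightarrow> 'a set set \<Rightarrow> 'a set set" where
  "cliques V E =
     {x. x \<subseteq> V \<and> x \<noteq> {} \<and> (\<forall>u\<in>x. \<forall>w\<in>x. u \<noteq> w \<longrightarrow> {u, w} \<in> E)}"

definition graph_euler_char :: "'a set \<Rightarrow> 'a set set \<Rightarrow> int" where
  "graph_euler_char V E = (\<Sum>x\<in>cliques V E. (- 1) ^ (card x - 1))"

definition locally_injective :: "'a set \<Rightarrow> 'a set set \<Rightarrow> ('a \<Rightarrow> real) \<Rightarrow> bool" where
  "locally_injective V E g \<longleftrightarrow> (\<forall>v\<in>V. \<forall>w\<in>V. {v, w} \<in> E \<longrightarrow> g v \<noteq> g w)"

definition lower_nbrs :: "'a set set \<Rightarrow> ('a \<Rightarrow> real) \<Rightarrow> 'a \<Rightarrow> 'a set" where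
  "lower_nbrs E g v = {w \<in> nbrs E v. g w < g v}"

definition graph_index :: "'a set set \<Rightarrow> ('a \<Rightarrow> real) \<Rightarrow> 'a \<Rightarrow> int" where
  "graph_index E g v =
     1 - graph_euler_char (lower_nbrs E g v) (induced_edges E (lower_nbrs E g v))"

text \<open>Functions on \<open>V\<close> are represented by their extensional versions, elements of
  \<open>V \<rightarrow>\<^sub>E UNIV\<close>; the map \<open>g \<mapsto> - g\<close> is therefore restricted to \<open>V\<close> when it is
  required to be an automorphism.\<close>

definition measure_automorphism :: "'b measure \<Rightarrow> ('b \<Rightarrow> 'b) \<Rightarrow> bool" where
  "measure_automorphism M T \<longleftrightarrow>
     bij_betw T (space M) (space M) \<and> T \<in> M \<rightarrow>\<^sub>M M \<and>
     the_inv_into (space M) T \<in> M \<rightarrow>\<^sub>M M \<and> distr M M T = M"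

definition index_curvature :: "('a \<Rightarrow> real) measure \<Rightarrow> 'a set set \<Rightarrow> 'a \<Rightarrow> real" where
  "index_curvature M E v = prob_space.expectation M (\<lambda>g. real_of_int (graph_index E g v))"

end

(* Negating g exchanges the lower and the upper neighbors of v, which partition the (q-1)-sphere
   S(v), so it suffices that the reduced Euler characteristics r(A), r(B) of the two parts of an
   even-dimensional sphere are opposite. In a d-sphere the signed count of the cliques containing a
   given (possibly empty) clique x is (-1)^(d+1), since it is (-1)^|x| times the reduced Euler
   characteristic of the link of x. Multiplying by (-1)^|x|, summing over x in A and exchanging the
   sums, only the cliques disjoint from A survive: (-1)^(d+1) r(A) = r(B). *)
theory Submission
  imports Defs
begin

section \<open>Signed clique counts with the empty clique included\<close>

text \<open>The empty clique is adjoined so that alternating sums become reduced Euler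
  characteristics (up to sign) and the family is closed under subsets.\<close>

definition faces :: "'a set \<Rightarrow> 'a set set \<Rightarrow> 'a set set" where
  "faces V E = insert {} (cliques V E)"

text \<open>Up to the sign \<open>(- 1) ^ card x\<close>, this is \<open>1 - \<chi>\<close> of the link of \<open>x\<close>.\<close>

definition signed_star :: "'a set \<Rightarrow> 'a set set \<Rightarrow> 'a set \<Rightarrow> int" where
  "signed_star V E x = (\<Sum>y | y \<in> faces V E \<and> x \<subseteq> y. (- 1) ^ card y)"

lemma mem_faces_iff:
  "x \<in> faces V E \<longleftrightarrow> x \<subseteq> V \<and> (\<forall>u\<in>x. \<forall>w\<in>x. u \<noteq> w \<longrightarrow> {u, w} \<in> E)"
  by (auto simp: faces_def cliques_def)

lemma faces_empty: "faces {} E = {{}}"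
  by (auto simp: mem_faces_iff)

lemma finite_faces: "finite V \<Longrightarrow> finite (faces V E)"
  by (rule finite_subset[of _ "Pow V"]) (auto simp: mem_faces_iff)

lemma finite_face: "finite V \<Longrightarrow> x \<in> faces V E \<Longrightarrow> finite x"
  by (auto simp: mem_faces_iff intro: finite_subset)

text \<open>A clique inside \<open>W\<close> only sees edges inside \<open>W\<close>; hence the edge
  set \<open>E\<close> can stay fixed while the recursion passes to subgraphs.\<close>

lemma faces_induced_edges: "faces W (induced_edges E W) = faces W E"
  by (auto simp: set_eq_iff mem_faces_iff induced_edges_def)

lemma signed_star_induced_edges: "signed_star W (induced_edges E W) = signed_star W E"
  by (simp add: fun_eq_iff signed_star_def faces_induced_edges)

lemma signed_star_empty: "signed_star V E {} = (\<Sum>y\<in>faces V E. (- 1) ^ card y)"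
  by (simp add: signed_star_def)

lemma signed_star_empty_eq:
  assumes "finite V"
  shows "signed_star V E {} = 1 - graph_euler_char V E"
proof -
  have fin: "finite (cliques V E)"
    using finite_faces[OF assms, of E] by (simp add: faces_def)
  have "(- 1) ^ card y = - ((- 1 :: int) ^ (card y - 1))" if "y \<in> cliques V E" for y
  proof -
    \<comment> \<open>The exponent \<open>card y - 1\<close> is a truncated difference, so the sign
      flips only because \<open>y\<close> is finite and nonempty.\<close>
    have "card y \<noteq> 0"
      using that assms by (auto simp: cliques_def dest: finite_subset)
    then show ?thesis by (cases "card y") auto
  qed
  then have "(\<Sum>y\<in>cliques V E. (- 1) ^ card y) = - graph_euler_char V E"
    unfolding graph_euler_char_def by (simp flip: sum_negf)
  moreover have "{} \<notin> cliques V E" by (simp add: cliques_def)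
  ultimately show ?thesis
    unfolding signed_star_empty faces_def using fin by simp
qed

section \<open>Neighborhoods and induced subgraphs of simple graphs\<close>

lemma simple_graph_edgeD:
  assumes "simple_graph V E" "{v, w} \<in> E"
  shows "w \<in> V" "v \<noteq> w"
proof -
  obtain a b where "a \<in> V" "b \<in> V" "a \<noteq> b" "{v, w} = {a, b}"
    using assms unfolding simple_graph_def by blast
  then show "w \<in> V" "v \<noteq> w" by (auto simp: doubleton_eq_iff)
qed

lemma nbrs_subset: "simple_graph V E \<Longrightarrow> nbrs E v \<subseteq> V"
  by (auto simp: nbrs_def dest: simple_graph_edgeD)

lemma not_mem_nbrs_self: "simple_graph V E \<Longrightarrow> v \<notin> nbrs E v"
  using simple_graph_edgeD(2)[of V E v v] by (auto simp: nbrs_def)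

lemma simple_graph_induced:
  assumes sg: "simple_graph V E" and W: "W \<subseteq> V"
  shows "simple_graph W (induced_edges E W)"
  unfolding simple_graph_def
proof (intro conjI ballI)
  show "finite W" using assms by (auto simp: simple_graph_def dest: finite_subset)
next
  fix e assume e: "e \<in> induced_edges E W"
  then obtain u v where "u \<noteq> v" "e = {u, v}"
    using sg unfolding simple_graph_def induced_edges_def by blast
  then show "\<exists>u\<in>W. \<exists>v\<in>W. u \<noteq> v \<and> e = {u, v}"
    using e by (auto simp: induced_edges_def)
qed

section \<open>Recursion at a vertex\<close>

text \<open>Deleting \<open>v\<close> is a bijection from the cliques containing \<open>v\<close> to
  the cliques of its unit sphere; it lowers the cardinality by one, whence the sign.\<close>

lemma signed_star_insert:
  assumes sg: "simple_graph V E" and v: "v \<in> V" and x: "v \<notin> x"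
  shows "signed_star V E (insert v x) = - signed_star (nbrs E v) E x"
proof -
  let ?N = "nbrs E v"
  have vN: "v \<notin> ?N" and NV: "?N \<subseteq> V"
    by (simp_all add: not_mem_nbrs_self[OF sg] nbrs_subset[OF sg])
  have fin: "finite V" using sg by (simp add: simple_graph_def)
  have "signed_star V E (insert v x) =
      (\<Sum>y | y \<in> faces ?N E \<and> x \<subseteq> y. - ((- 1) ^ card y))"
    unfolding signed_star_def
  proof (rule sum.reindex_bij_witness[of _ "insert v" "\<lambda>y. y - {v}"])
    fix y assume y: "y \<in> {y. y \<in> faces V E \<and> insert v x \<subseteq> y}"
    then show "insert v (y - {v}) = y" by auto
    show "y - {v} \<in> {y. y \<in> faces ?N E \<and> x \<subseteq> y}"
      using y x by (auto simp: mem_faces_iff nbrs_def)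
    have "card y = Suc (card (y - {v}))"
      using y finite_face[OF fin] by (intro card.remove) auto
    then show "- ((- 1) ^ card (y - {v})) = (- 1 :: int) ^ card y" by simp
  next
    fix y assume y: "y \<in> {y. y \<in> faces ?N E \<and> x \<subseteq> y}"
    then show "insert v y - {v} = y" using vN by (auto simp: mem_faces_iff)
    have "{v, w} \<in> E" "{w, v} \<in> E" if "w \<in> y" for w
      using y that by (auto simp: mem_faces_iff nbrs_def insert_commute)
    then show "insert v y \<in> {y. y \<in> faces V E \<and> insert v x \<subseteq> y}"
      using y v NV by (auto simp: mem_faces_iff)
  qed
  then show ?thesis by (simp add: signed_star_def sum_negf)
qed

text \<open>Cliques are sorted by whether they contain \<open>v\<close>; those that do are counted
  in the unit sphere.\<close>

lemma signed_star_remove_vertex: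
  assumes sg: "simple_graph V E" and v: "v \<in> V"
  shows "signed_star V E {} = signed_star (V - {v}) E {} - signed_star (nbrs E v) E {}"
proof -
  have fin: "finite (faces V E)"
    using sg by (intro finite_faces) (simp add: simple_graph_def)
  let ?S = "{y. y \<in> faces V E \<and> {v} \<subseteq> y}"
  have split: "faces V E = faces (V - {v}) E \<union> ?S"
    by (auto simp: mem_faces_iff)
  have "faces (V - {v}) E \<inter> ?S = {}"
    by (auto simp: mem_faces_iff)
  moreover have "finite (faces (V - {v}) E)" "finite ?S"
    using fin split by (metis finite_Un)+
  ultimately have "signed_star V E {} = signed_star (V - {v}) E {} + signed_star V E {v}"
    unfolding signed_star_empty signed_star_def[of V E "{v}"]
    by (subst split) (rule sum.union_disjoint)
  then show ?thesis using signed_star_insert[OF assms, of "{}"] by simp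
qed

section \<open>Values on contractible graphs and spheres\<close>

text \<open>For one vertex the empty clique and the vertex cancel; otherwise both terms of the
  vertex recursion vanish by induction.\<close>

lemma signed_star_contractible:
  "contractible_graph V E \<Longrightarrow> simple_graph V E \<Longrightarrow> signed_star V E {} = 0"
proof (induction rule: contractible_graph.induct)
  case (K1 v)
  have "faces {v} {} = {{}, {v}}" by (auto simp: mem_faces_iff)
  then show ?case by (simp add: signed_star_empty)
next
  case (extend v V E)
  have "simple_graph (nbrs E v) (induced_edges E (nbrs E v))"
    "simple_graph (V - {v}) (induced_edges E (V - {v}))"
    using extend.prems by (auto intro!: simple_graph_induced dest: nbrs_subset)
  then show ?case
    using extend signed_star_remove_vertex[OF extend.prems extend.hyps(1)]
    by (simp add: signed_star_induced_edges)
qed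

lemma graph_manifold_nbrs_sphere:
  assumes "graph_manifold q V E"
  shows "q \<ge> 0"
    and "v \<in> V \<Longrightarrow> graph_sphere (q - 1) (nbrs E v) (induced_edges E (nbrs E v))"
  using assms by (simp_all add: graph_manifold.simps[of q V E])

text \<open>Mutual induction. The manifold half speaks only of unit spheres, of dimension
  \<open>q - 1\<close>: the manifold property by itself does not fix the count at the empty clique,
  which the sphere half gets from the vertex with contractible complement.\<close>

lemma signed_star_sphere_manifold:
  "graph_sphere q V E \<Longrightarrow> simple_graph V E \<longrightarrow>
     (\<forall>x\<in>faces V E. signed_star V E x = (- 1) ^ nat (q + 1))"
  "graph_manifold q V E \<Longrightarrow> simple_graph V E \<longrightarrow> q \<ge> 0 \<and>
     (\<forall>v\<in>V. \<forall>x\<in>faces (nbrs E v) E. signed_star (nbrs E v) E x = (- 1) ^ nat q)"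
proof (induction rule: graph_sphere_graph_manifold.inducts)
  case empty_sphere
  show ?case by (simp add: faces_empty signed_star_empty)
next
  case (manifold q V E)
  show ?case
  proof (intro impI conjI ballI)
    fix v x assume sg: "simple_graph V E" and "v \<in> V" "x \<in> faces (nbrs E v) E"
    then show "signed_star (nbrs E v) E x = (- 1) ^ nat q"
      using manifold(2) simple_graph_induced[OF sg nbrs_subset[OF sg, of v]]
      by (simp add: faces_induced_edges signed_star_induced_edges)
  qed (use manifold in simp)
next
  case (sphere q V E v)
  show ?case
  proof (intro impI ballI)
    fix x assume sg: "simple_graph V E" and x: "x \<in> faces V E"
    have IH: "signed_star (nbrs E w) E y = (- 1) ^ nat q"
      if "w \<in> V" "y \<in> faces (nbrs E w) E" for w y
      using sphere.IH sg that by blast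
    have "q \<ge> 0" using sphere.IH sg by blast
    then have pow: "(- 1 :: int) ^ nat (q + 1) = - ((- 1) ^ nat q)"
      by (simp add: nat_add_distrib)
    show "signed_star V E x = (- 1) ^ nat (q + 1)"
    proof (cases "x = {}")
      case True
      \<comment> \<open>Removing the vertex with contractible complement leaves only the
        contribution of its unit sphere.\<close>
      have "signed_star (V - {v}) E {} = 0"
        using signed_star_contractible[OF sphere.hyps(3)] simple_graph_induced[OF sg]
        by (simp add: signed_star_induced_edges)
      then show ?thesis
        using True signed_star_remove_vertex[OF sg sphere.hyps(2)] IH[OF sphere.hyps(2), of "{}"] pow
        by (simp add: mem_faces_iff)
    next
      case False
      \<comment> \<open>Any vertex of \<open>x\<close> serves: the count at \<open>x\<close> is
        minus the count at \<open>x - {w}\<close> in the unit sphere of \<open>w\<close>.\<close>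
      then obtain w where w: "w \<in> x" by blast
      then have wV: "w \<in> V" and "x - {w} \<in> faces (nbrs E w) E"
        using x by (auto simp: mem_faces_iff nbrs_def)
      then show ?thesis
        using signed_star_insert[OF sg wV, of "x - {w}"] IH pow w by (simp add: insert_absorb)
    qed
  qed
qed

section \<open>Duality between complementary vertex sets of a sphere\<close>

text \<open>Toggling a fixed element \<open>s\<close> pairs the subsets with opposite signs.\<close>

lemma alternating_sum_Pow:
  assumes "finite S"
  shows "(\<Sum>x\<in>Pow S. (- 1 :: int) ^ card x) = (if S = {} then 1 else 0)"
proof (cases "S = {}")
  case False
  then obtain s where s: "s \<in> S" by blast
  then have eq: "Pow S = Pow (S - {s}) \<union> insert s ` Pow (S - {s})"
    by (metis Pow_insert insert_Diff)
  have inj: "inj_on (insert s) (Pow (S - {s}))" by (auto simp: inj_on_def)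
  have "card (insert s x) = Suc (card x)" if "x \<in> Pow (S - {s})" for x
    using that assms by (subst card_insert_disjoint) (auto dest: finite_subset)
  then have "(\<Sum>x\<in>insert s ` Pow (S - {s}). (- 1 :: int) ^ card x)
      = - (\<Sum>x\<in>Pow (S - {s}). (- 1) ^ card x)"
    by (simp add: sum.reindex[OF inj] sum_negf)
  moreover have "Pow (S - {s}) \<inter> insert s ` Pow (S - {s}) = {}" by auto
  ultimately show ?thesis
    using False assms by (subst eq, subst sum.union_disjoint) auto
qed simp

text \<open>This is Alexander duality at the level of Euler characteristics.\<close>

lemma sphere_complement_duality:
  assumes "graph_sphere d V E" and sg: "simple_graph V E" and A: "A \<subseteq> V"
  shows "signed_star (V - A) E {} = (- 1) ^ nat (d + 1) * signed_star A E {}"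
proof -
  have finV: "finite V" using sg by (simp add: simple_graph_def)
  have finF: "finite (faces V E)" "finite (faces A E)"
    using finV A finite_faces finite_subset by metis+
  let ?s = "\<lambda>x :: 'a set. (- 1 :: int) ^ card x"
  have "?s x * signed_star V E x = (- 1) ^ nat (d + 1) * ?s x" if "x \<in> faces A E" for x
  proof -
    have "x \<in> faces V E" using that A by (auto simp: mem_faces_iff)
    then show ?thesis using signed_star_sphere_manifold(1)[OF assms(1)] sg by simp
  qed
  then have "(- 1) ^ nat (d + 1) * signed_star A E {} =
      (\<Sum>x\<in>faces A E. ?s x * signed_star V E x)"
    by (simp add: signed_star_def sum_distrib_left)
  also have "\<dots> = (\<Sum>x\<in>faces A E. \<Sum>y | y \<in> faces V E \<and> x \<subseteq> y. ?s x * ?s y)"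
    by (simp add: signed_star_def sum_distrib_left)
  also have "\<dots> = (\<Sum>y\<in>faces V E. \<Sum>x | x \<in> faces A E \<and> x \<subseteq> y. ?s x * ?s y)"
    by (rule sum.swap_restrict[OF finF(2,1)])
  also have "\<dots> = (\<Sum>y\<in>faces V E. if y \<inter> A = {} then ?s y else 0)"
  proof (rule sum.cong[OF refl])
    fix y assume y: "y \<in> faces V E"
    \<comment> \<open>Every subset of a clique is a clique, so the inner sum runs over a full power
      set and cancels unless \<open>y\<close> misses \<open>A\<close>.\<close>
    then have "{x. x \<in> faces A E \<and> x \<subseteq> y} = Pow (y \<inter> A)"
      by (auto simp: mem_faces_iff)
    moreover have "finite (y \<inter> A)" using finite_face[OF finV y] by simp
    ultimately show "(\<Sum>x | x \<in> faces A E \<and> x \<subseteq> y. ?s x * ?s y) = (if y \<inter> A = {} then ?s y else 0)"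
      using alternating_sum_Pow[of "y \<inter> A"] by (simp flip: sum_distrib_right)
  qed
  also have "\<dots> = (\<Sum>y | y \<in> faces V E \<and> y \<inter> A = {}. ?s y)"
    using finF(1) by (rule sum.inter_filter[symmetric])
  also have "{y. y \<in> faces V E \<and> y \<inter> A = {}} = {y. y \<in> faces (V - A) E \<and> {} \<subseteq> y}"
    by (auto simp: mem_faces_iff)
  finally show ?thesis by (simp add: signed_star_def)
qed

section \<open>The index under negation, and its expectation\<close>

lemma graph_index_uminus:
  assumes "odd q" and sg: "simple_graph V E" and mf: "graph_manifold q V E"
    and inj: "locally_injective V E g" and v: "v \<in> V"
  shows "graph_index E (\<lambda>v\<in>V. - g v) v = - graph_index E g v"
proof -
  let ?N = "nbrs E v"
  let ?E = "induced_edges E ?N"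
  let ?A = "lower_nbrs E g v"
  let ?B = "lower_nbrs E (\<lambda>v\<in>V. - g v) v"
  have NV: "?N \<subseteq> V" and finN: "finite ?N"
    using sg nbrs_subset[OF sg, of v] by (auto simp: simple_graph_def dest: finite_subset)
  have AN: "?A \<subseteq> ?N" by (auto simp: lower_nbrs_def)
  have "g w \<noteq> g v" if "w \<in> ?N" for w
    using that inj v NV by (force simp: locally_injective_def nbrs_def)
  \<comment> \<open>Local injectivity excludes ties, so the neighbors not below \<open>v\<close> are
    strictly above it and become the lower ones for \<open>- g\<close>; the restriction to
    \<open>V\<close> is harmless as \<open>v\<close> and its neighbors lie in
    \<open>V\<close>.\<close>
  then have B: "?B = ?N - ?A"
    using v NV by (force simp: lower_nbrs_def)
  \<comment> \<open>Duality is applied inside the unit sphere with edge set \<open>?E\<close>,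
    whereas the index is defined from \<open>E\<close>; both give the same cliques on subsets of
    \<open>?N\<close>.\<close>
  have index: "graph_index E h v = signed_star (lower_nbrs E h v) ?E {}" for h
  proof -
    have LN: "lower_nbrs E h v \<subseteq> ?N" by (auto simp: lower_nbrs_def)
    then have "faces (lower_nbrs E h v) ?E = faces (lower_nbrs E h v) E"
      by (auto simp: set_eq_iff mem_faces_iff induced_edges_def)
    then have "signed_star (lower_nbrs E h v) ?E {} = signed_star (lower_nbrs E h v) E {}"
      by (simp add: signed_star_def)
    then show ?thesis
      using signed_star_empty_eq[OF finite_subset[OF LN finN]]
      by (metis graph_index_def signed_star_induced_edges)
  qed
  have "q \<ge> 0" using graph_manifold_nbrs_sphere(1)[OF mf] .
  \<comment> \<open>The unit sphere has dimension \<open>q - 1\<close>, so the exponent in the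
    duality is \<open>nat q\<close> and the factor is -1.\<close>
  then have "odd (nat q)" using \<open>odd q\<close> by (simp add: even_nat_iff)
  then have "signed_star ?B ?E {} = - signed_star ?A ?E {}"
    using sphere_complement_duality[OF graph_manifold_nbrs_sphere(2)[OF mf v]
        simple_graph_induced[OF sg NV] AN] B by simp
  then show ?thesis by (simp add: index)
qed

theorem mainTheorem13:
  fixes V :: "'a set" and E :: "'a set set" and q :: int
    and M :: "('a \<Rightarrow> real) measure"
  assumes "odd q"
    and "simple_graph V E"
    and "graph_manifold q V E"
    and "prob_space M"
    and "space M \<subseteq> {g \<in> V \<rightarrow>\<^sub>E UNIV. locally_injective V E g}"
    and "\<forall>v\<in>V. (\<lambda>g. real_of_int (graph_index E g v)) \<in> borel_measurable M"
    and "measure_automorphism M (\<lambda>g. \<lambda>v\<in>V. - g v)"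
  shows "\<forall>v\<in>V. index_curvature M E v = 0"
proof
  fix v assume v: "v \<in> V"
  let ?T = "\<lambda>g :: 'a \<Rightarrow> real. \<lambda>v\<in>V. - g v"
  let ?f = "\<lambda>g. real_of_int (graph_index E g v)"
  have T: "?T \<in> M \<rightarrow>\<^sub>M M" and distr: "distr M M ?T = M"
    using assms(7) by (simp_all add: measure_automorphism_def)
  have f: "?f \<in> borel_measurable M" using assms(6) v by blast
  \<comment> \<open>Invariance of \<open>M\<close> under negation makes the expectation equal to its
    own negative.\<close>
  have "integral\<^sup>L M ?f = integral\<^sup>L (distr M M ?T) ?f" by (simp only: distr)
  also have "\<dots> = (\<integral>g. ?f (?T g) \<partial>M)" by (rule integral_distr[OF T f])
  also have "\<dots> = (\<integral>g. - ?f g \<partial>M)"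
  proof (rule Bochner_Integration.integral_cong[OF refl])
    fix g assume "g \<in> space M"
    then have "locally_injective V E g" using assms(5) by blast
    then show "?f (?T g) = - ?f g"
      using graph_index_uminus[OF assms(1-3) _ v] by simp
  qed
  also have "\<dots> = - integral\<^sup>L M ?f" by simp
  finally show "index_curvature M E v = 0" by (simp add: index_curvature_def)
qed

end
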